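(* Let $n\in\mathbb N$, $a>0$, $\alpha>0$ and $t_*\ge 0$. Let $y\in C^1([t_*,\infty),\mathbb R^n)$ satisfy $y(t)\ne 0$ for all $t\ge t_*$, $\lim_{t\to\infty}y(t)=0$, and $$y'=-a|y|^\alpha y+f(t)\quad\text{for }t>t_*,$$ where $f:[t_*,\infty)\to\mathbb R^n$ is a continuous function such that, for some constants $M,\delta>0$, $|f(t)|\le M|y(t)|^{\alpha+1+\delta}$ for all $t\ge t_*$. Then there exists a nonzero vector $\xi_*\in\mathbb R^n$ such that, as $t\to\infty$, $$|y(t)-\xi_* t^{-1/\alpha}|=\mathcal O(t^{-1/\alpha-\varepsilon})\quad\text{for some }\varepsilon>0.$$ Moreover, $$\alpha a|\xi_*|^\alpha=1.$$
   Context: $|\cdot|$ is the Euclidean norm on $\mathbb R^n$. For nonnegative functions $f,g$ defined for large $t$, $f(t)=\mathcal O(g(t))$ as $t\to\infty$ means there are $T'$ and $C>0$ with $f(t)\le Cg(t)$ for all $t\ge T'$. *)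

theory Defs
  imports "HOL-Analysis.Analysis" "HOL-Library.Landau_Symbols"
begin

end

theory Submission
  imports Defs
begin

text \<open>The radial and the angular part of the solution are treated separately. The function
  \<open>u = norm y powr - \<alpha>\<close> satisfies \<open>u' = \<alpha> * a + O(norm y powr \<delta>)\<close>; this first gives linear growth of
  \<open>u\<close>, and, fed back into the error term, \<open>u = \<alpha> * a * t + O(t powr (1 - \<kappa>))\<close>. The leading term of
  the equation is radial, so the direction \<open>sgn y\<close> feels only \<open>f\<close>: its derivative is
  \<open>O(t powr (- 1 - \<kappa>))\<close>, hence integrable, and \<open>sgn y\<close> converges at the rate \<open>t powr - \<kappa>\<close>.\<close>

text \<open>Comparing two late values with the one at a time \<open>S\<close> where
  \<open>h S < e / 2\<close> gives the Cauchy property, and completeness gives \<open>L\<close>.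
  Letting \<open>t\<close> tend to infinity in \<open>gh\<close> then turns the oscillation bound
  into a rate of convergence.\<close>

lemma tendsto_at_top_with_rate:
  fixes g :: "real \<Rightarrow> 'a::banach"
  assumes h: "(h \<longlongrightarrow> 0) at_top"
    and gh: "\<And>s t. T \<le> s \<Longrightarrow> s \<le> t \<Longrightarrow> norm (g t - g s) \<le> h s"
  obtains L where "(g \<longlongrightarrow> L) at_top" "\<And>s. T \<le> s \<Longrightarrow> norm (g s - L) \<le> h s"
proof -
  have "cauchy_filter (filtermap g at_top)"
    unfolding cauchy_filter_metric_filtermap
  proof (intro allI impI)
    fix e :: real assume "e > 0"
    then have "\<forall>\<^sub>F s in at_top. h s < e / 2"
      using order_tendstoD(2)[OF h, of "e / 2"] by simp
    then have "\<forall>\<^sub>F s in at_top. h s < e / 2 \<and> T \<le> s"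
      using eventually_ge_at_top by (rule eventually_conj)
    then obtain S where S: "h S < e / 2" "T \<le> S"
      using eventually_happens'[OF trivial_limit_at_top_linorder] by blast
    have "dist (g x) (g z) < e" if "S \<le> x" "S \<le> z" for x z
    proof -
      have "dist (g x) (g S) \<le> h S" "dist (g z) (g S) \<le> h S"
        using gh[OF S(2)] that by (auto simp: dist_norm)
      then show ?thesis
        using S dist_triangle2[of "g x" "g z" "g S"] by linarith
    qed
    then show "\<exists>P. eventually P at_top \<and> (\<forall>x z. P x \<and> P z \<longrightarrow> dist (g x) (g z) < e)"
      using eventually_ge_at_top[of S] by (intro exI[of _ "\<lambda>x. S \<le> x"]) auto
  qed
  then have "\<exists>L. filtermap g at_top \<le> nhds L"
    by (rule cauchy_filter_complete_converges[OF _ complete_UNIV]) (auto simp: filtermap_bot_iff)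
  then obtain L where L: "(g \<longlongrightarrow> L) at_top"
    by (auto simp: filterlim_def)
  have "norm (g s - L) \<le> h s" if "T \<le> s" for s
  proof (rule tendsto_upperbound)
    show "((\<lambda>t. norm (g s - g t)) \<longlongrightarrow> norm (g s - L)) at_top"
      by (intro tendsto_intros L)
    show "\<forall>\<^sub>F t in at_top. norm (g s - g t) \<le> h s"
      using eventually_ge_at_top[of s] by (rule eventually_mono) (metis gh[OF that] norm_minus_commute)
  qed simp
  with L show thesis by (rule that)
qed

text \<open>Mean value inequality with a scalar majorant. It stands in for integrating the
  derivative bound: each application only has to exhibit an antiderivative
  \<open>\<phi>\<close>.\<close>

lemma norm_diff_le_of_derivative_bound:
  fixes g :: "real \<Rightarrow> 'a::real_normed_vector"
  assumes "s \<le> t"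
    and g: "\<And>x. s \<le> x \<Longrightarrow> (g has_vector_derivative g' x) (at x)"
    and \<phi>: "\<And>x. s \<le> x \<Longrightarrow> (\<phi> has_real_derivative \<phi>' x) (at x)"
    and bound: "\<And>x. s \<le> x \<Longrightarrow> norm (g' x) \<le> \<phi>' x"
  shows "norm (g t - g s) \<le> \<phi> t - \<phi> s"
proof (cases "s = t")
  case False
  show ?thesis
  proof (rule differentiable_bound_general[where f' = g' and \<phi>' = \<phi>'])
    show "s < t" using False assms(1) by simp
    show "continuous_on {s..t} g"
      using g by (intro continuous_at_imp_continuous_on) (auto intro!: has_vector_derivative_continuous)
    show "continuous_on {s..t} \<phi>"
      using \<phi> by (intro continuous_at_imp_continuous_on) (auto intro!: DERIV_isCont)
  qed (use g \<phi> bound in \<open>auto simp: has_real_derivative_iff_has_vector_derivative\<close>)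
qed simp

lemma has_real_derivative_norm:
  fixes y :: "real \<Rightarrow> 'a::real_inner"
  assumes y: "(y has_vector_derivative v) (at t)" and nz: "y t \<noteq> 0"
  shows "((\<lambda>t. norm (y t)) has_real_derivative inner v (sgn (y t))) (at t)"
proof -
  have "((\<lambda>t. norm (y t)) has_derivative (\<lambda>h. inner (h *\<^sub>R v) (sgn (y t)))) (at t)"
    using y has_derivative_norm[OF nz] unfolding has_vector_derivative_def
    by (rule has_derivative_compose)
  then show ?thesis
    by (simp add: has_field_derivative_def mult.commute[of _ "inner v (sgn (y t))"])
qed

text \<open>The quotient rule leaves the component of \<open>v\<close> orthogonal to
  \<open>y t\<close>, divided by the norm, so a multiple of \<open>y t\<close> inside
  \<open>v\<close> contributes nothing.\<close>

lemma has_vector_derivative_sgn: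
  fixes y :: "real \<Rightarrow> 'a::real_inner"
  assumes y: "(y has_vector_derivative v) (at t)" and nz: "y t \<noteq> 0"
  shows "((\<lambda>t. sgn (y t)) has_vector_derivative
           (1 / norm (y t)) *\<^sub>R (v - inner v (sgn (y t)) *\<^sub>R sgn (y t))) (at t)"
proof -
  have "((\<lambda>t. inverse (norm (y t)) *\<^sub>R y t) has_vector_derivative
      inverse (norm (y t)) *\<^sub>R v
        + (- (inverse (norm (y t)) * inner v (sgn (y t)) * inverse (norm (y t)))) *\<^sub>R y t) (at t)"
    using nz
    by (intro has_vector_derivative_scaleR y DERIV_inverse' has_real_derivative_norm) auto
  then show ?thesis
    by (simp add: sgn_div_norm algebra_simps divide_inverse)
qed

text \<open>The derivative of \<open>x powr - p\<close> decreases in absolute value, so on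
  \<open>{m..}\<close> the mean value bound takes its value at \<open>m\<close>.\<close>

lemma abs_powr_diff_le:
  fixes p :: real
  assumes "p \<ge> 0" "m > 0" "u \<ge> m" "v \<ge> m"
  shows "\<bar>u powr - p - v powr - p\<bar> \<le> p * m powr (- p - 1) * \<bar>u - v\<bar>"
proof -
  have "norm (u powr - p - v powr - p) \<le> p * m powr (- p - 1) * norm (u - v)"
  proof (rule field_differentiable_bound[where S = "{m..}"])
    fix z assume z: "z \<in> {m..}"
    then show "((\<lambda>x. x powr - p) has_field_derivative - p * z powr (- p - 1)) (at z within {m..})"
      using assms by (intro has_field_derivative_at_within[OF has_real_derivative_powr]) auto
    show "norm (- p * z powr (- p - 1)) \<le> p * m powr (- p - 1)"
      using assms z by (auto simp: abs_mult intro!: mult_left_mono powr_mono2')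
  qed (use assms in auto)
  then show ?thesis by simp
qed

theorem theorem2p1:
  fixes a \<alpha> tstar M \<delta> :: real
    and y y' f :: "real \<Rightarrow> real ^ 'n"
  assumes "a > 0" and "\<alpha> > 0" and "tstar \<ge> 0"
    and "\<forall>t\<ge>tstar. (y has_vector_derivative y' t) (at t within {tstar..})"
    and "continuous_on {tstar..} y'"
    and "\<forall>t\<ge>tstar. y t \<noteq> 0"
    and "(y \<longlongrightarrow> 0) at_top"
    and "\<forall>t>tstar. y' t = - (a * norm (y t) powr \<alpha>) *\<^sub>R y t + f t"
    and "continuous_on {tstar..} f"
    and "M > 0" and "\<delta> > 0"
    and "\<forall>t\<ge>tstar. norm (f t) \<le> M * norm (y t) powr (\<alpha> + 1 + \<delta>)"
  shows "\<exists>\<xi> :: real ^ 'n. \<xi> \<noteq> 0 \<and>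
           (\<exists>\<epsilon>>0. (\<lambda>t. norm (y t - t powr (- 1 / \<alpha>) *\<^sub>R \<xi>))
                      \<in> O[at_top](\<lambda>t. t powr (- 1 / \<alpha> - \<epsilon>))) \<and>
           \<alpha> * a * norm \<xi> powr \<alpha> = 1"
proof -

  \<comment> \<open>Polar decomposition \<open>y = r e\<close>\<close>
  note pos = \<open>a > 0\<close> \<open>\<alpha> > 0\<close> \<open>M > 0\<close> \<open>\<delta> > 0\<close>
  \<comment> \<open>The cap \<open>1 / 2\<close> keeps \<open>\<kappa> < 1\<close>, so that
    \<open>t powr - \<kappa>\<close> has the growing antiderivative
    \<open>t powr (1 - \<kappa>) / (1 - \<kappa>)\<close> whatever the size of
    \<open>\<delta> / \<alpha>\<close>.\<close>
  define \<kappa> where "\<kappa> = min (\<delta> / \<alpha>) (1 / 2)"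
  have \<kappa>: "\<kappa> > 0" "\<kappa> < 1" "\<kappa> \<le> \<delta> / \<alpha>" using pos by (auto simp: \<kappa>_def)
  define r where "r t = norm (y t)" for t
  define e where "e t = sgn (y t)" for t
  define u where "u t = r t powr - \<alpha>" for t
  \<comment> \<open>The unperturbed slope of \<open>u\<close> is
    \<open>\<alpha> * a = 4 * c\<close>. The perturbation will cost at most \<open>2 * c\<close>,
    and the delay \<open>T1\<close> another \<open>c\<close>, which leaves
    \<open>u t \<ge> c * t\<close>.\<close>
  define c where "c = \<alpha> * a / 4"
  have c: "c > 0" using pos by (simp add: c_def)
  have y_deriv: "(y has_vector_derivative y' t) (at t)" if "t > tstar" for t
    using assms(4) that by (metis at_within_interior interior_real_atLeast greaterThan_iff less_imp_le)
  have r_pos: "r t > 0" and norm_e: "norm (e t) = 1" if "t > tstar" for t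
    using assms(6) that by (auto simp: r_def e_def norm_sgn)
  have y_eq: "y t = r t *\<^sub>R e t" for t
    by (cases "y t = 0") (auto simp: r_def e_def sgn_div_norm)
  have y'_eq: "y' t = - (a * r t powr (\<alpha> + 1)) *\<^sub>R e t + f t" if "t > tstar" for t
    using assms(8) that r_pos[OF that] by (simp add: y_eq[of t] r_def[symmetric] powr_add mult_ac)
  have f_le: "norm (f t) \<le> M * r t powr (\<alpha> + 1 + \<delta>)" if "t > tstar" for t
    using assms(12) that by (simp add: r_def)
  have fe_le: "\<bar>inner (f t) (e t)\<bar> \<le> M * r t powr (\<alpha> + 1 + \<delta>)" if "t > tstar" for t
    using Cauchy_Schwarz_ineq2[of "f t" "e t"] f_le[OF that] norm_e[OF that] by simp
  have y'_inner: "inner (y' t) (e t) = - (a * r t powr (\<alpha> + 1)) + inner (f t) (e t)" if "t > tstar" for t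
    using norm_e[OF that]
    by (simp add: y'_eq[OF that] inner_diff_left norm_eq_1)

  \<comment> \<open>Derivative of \<open>u = r powr - \<alpha>\<close>\<close>
  define u' where "u' t = \<alpha> * a - \<alpha> * r t powr (- \<alpha> - 1) * inner (f t) (e t)" for t
  have u_deriv: "(u has_real_derivative u' t) (at t)" if t: "t > tstar" for t
  proof -
    have "(r has_real_derivative inner (y' t) (e t)) (at t)"
      unfolding r_def e_def using y_deriv[OF t] assms(6) t by (intro has_real_derivative_norm) auto
    then have "(u has_real_derivative - \<alpha> * r t powr (- \<alpha> - of_nat 1) * inner (y' t) (e t)) (at t)"
      unfolding u_def using r_pos[OF t] by (rule DERIV_fun_powr)
    also have "- \<alpha> * r t powr (- \<alpha> - of_nat 1) * inner (y' t) (e t)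
        = \<alpha> * a * (r t powr (- \<alpha> - 1) * r t powr (\<alpha> + 1)) - \<alpha> * r t powr (- \<alpha> - 1) * inner (f t) (e t)"
      by (simp add: y'_inner[OF t] algebra_simps)
    \<comment> \<open>The exponents \<open>- \<alpha> - 1\<close> and \<open>\<alpha> + 1\<close>
      cancel because \<open>r t > 0\<close>: this choice of \<open>u\<close> turns the damping into
      a constant.\<close>
    also have "\<dots> = u' t"
      using r_pos[OF t] by (simp add: u'_def flip: powr_add)
    finally show ?thesis .
  qed
  have u'_le: "\<bar>u' t - \<alpha> * a\<bar> \<le> \<alpha> * M * r t powr \<delta>" if t: "t > tstar" for t
  proof -
    have "\<bar>u' t - \<alpha> * a\<bar> = \<alpha> * r t powr (- \<alpha> - 1) * \<bar>inner (f t) (e t)\<bar>"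
      using pos by (simp add: u'_def abs_mult)
    also have "\<dots> \<le> \<alpha> * r t powr (- \<alpha> - 1) * (M * r t powr (\<alpha> + 1 + \<delta>))"
      using pos by (intro mult_left_mono fe_le t) auto
    also have "\<dots> = \<alpha> * M * (r t powr (- \<alpha> - 1) * r t powr (\<alpha> + 1 + \<delta>))" by simp
    also have "\<dots> = \<alpha> * M * r t powr \<delta>"
      by (simp flip: powr_add)
    finally show ?thesis .
  qed

  \<comment> \<open>Derivative of the direction \<open>e\<close>\<close>
  define e' where "e' t = (1 / r t) *\<^sub>R (f t - inner (f t) (e t) *\<^sub>R e t)" for t
  have e_deriv: "(e has_vector_derivative e' t) (at t)" if t: "t > tstar" for t
  proof -
    have "(e has_vector_derivative (1 / r t) *\<^sub>R (y' t - inner (y' t) (e t) *\<^sub>R e t)) (at t)"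
      unfolding r_def e_def using y_deriv[OF t] assms(6) t by (intro has_vector_derivative_sgn) auto
    \<comment> \<open>The damping is a multiple of the unit vector \<open>e t\<close>, hence equals
      its own radial projection and drops out.\<close>
    also have "y' t - inner (y' t) (e t) *\<^sub>R e t = f t - inner (f t) (e t) *\<^sub>R e t"
      using norm_e[OF t] by (simp add: y'_eq[OF t] norm_eq_1 algebra_simps)
    finally show ?thesis by (simp add: e'_def)
  qed
  \<comment> \<open>The 2 counts \<open>f t\<close> and its radial projection. Dividing by
    \<open>r t\<close> lowers the exponent to \<open>\<alpha> + \<delta>\<close>, written as a
    product because the two factors get separate decay bounds.\<close>
  have e'_le: "norm (e' t) \<le> 2 * M * (r t powr \<alpha> * r t powr \<delta>)" if t: "t > tstar" for t
  proof -
    have "norm (f t - inner (f t) (e t) *\<^sub>R e t) \<le> norm (f t) + \<bar>inner (f t) (e t)\<bar>"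
      using norm_triangle_ineq4[of "f t" "inner (f t) (e t) *\<^sub>R e t"] norm_e[OF t] by simp
    also have "\<dots> \<le> 2 * M * r t powr (\<alpha> + 1 + \<delta>)"
      using f_le[OF t] fe_le[OF t] by simp
    also have "\<dots> = 2 * M * (r t powr \<alpha> * r t powr \<delta>) * r t"
      using r_pos[OF t] by (simp add: powr_add)
    finally show ?thesis
      using r_pos[OF t] by (simp add: e'_def pos_divide_le_eq)
  qed

  \<comment> \<open>Linear lower bound for \<open>u\<close> and decay of \<open>r\<close>\<close>
  have r_lim: "(r \<longlongrightarrow> 0) at_top"
    unfolding r_def using assms(7) by (rule tendsto_norm_zero)
  have "((\<lambda>t. \<alpha> * M * r t powr \<delta>) \<longlongrightarrow> \<alpha> * M * 0) at_top"
    using pos by (intro tendsto_intros tendsto_zero_powrI[OF r_lim tendsto_const]) (auto simp: r_def)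
  then have "\<forall>\<^sub>F t in at_top. \<alpha> * M * r t powr \<delta> < 2 * c"
    using c by (intro order_tendstoD(2)) auto
  then obtain T0 where T0: "\<alpha> * M * r t powr \<delta> < 2 * c" if "t \<ge> T0" for t
    unfolding eventually_at_top_linorder by blast
  \<comment> \<open>Adding 1 moves strictly past \<open>tstar\<close>, where two-sided derivatives
    exist, and makes \<open>T1\<close> positive.\<close>
  define T1 where "T1 = max T0 (tstar + 1)"
  have u_diff1: "\<bar>(u t - \<alpha> * a * t) - (u T1 - \<alpha> * a * T1)\<bar> \<le> 2 * c * t - 2 * c * T1" if "T1 \<le> t" for t
    unfolding real_norm_def[symmetric] using that
  proof (rule norm_diff_le_of_derivative_bound)
    fix x assume "T1 \<le> x"
    then have x: "x > tstar" "x \<ge> T0" by (auto simp: T1_def)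
    show "((\<lambda>t. u t - \<alpha> * a * t) has_vector_derivative u' x - \<alpha> * a) (at x)"
      unfolding has_real_derivative_iff_has_vector_derivative[symmetric]
      by (auto intro!: derivative_eq_intros u_deriv x)
    show "((\<lambda>t. 2 * c * t) has_real_derivative 2 * c) (at x)"
      by (auto intro!: derivative_eq_intros)
    show "norm (u' x - \<alpha> * a) \<le> 2 * c"
      using u'_le[OF x(1)] T0[OF x(2)] by simp
  qed
  \<comment> \<open>From \<open>2 * T1\<close> on, \<open>2 * c * (t - T1) \<ge> c * t\<close>; the
    1 makes powers of \<open>t\<close> monotone in the exponent.\<close>
  define T where "T = max (2 * T1) 1"
  have "T1 > 0" "T1 > tstar" using assms(3) by (auto simp: T1_def)
  have T: "T \<ge> 1" "\<And>t. t \<ge> T \<Longrightarrow> t \<ge> 1 \<and> t > tstar \<and> t > 0"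
    using \<open>T1 > 0\<close> \<open>T1 > tstar\<close> by (auto simp: T_def)
  have u_ge: "u t \<ge> c * t" if "t \<ge> T" for t
  proof -
    have t: "t \<ge> 2 * T1" using that by (simp add: T_def)
    have "u T1 \<ge> 0" by (simp add: u_def)
    moreover have "\<alpha> * a = 4 * c" by (simp add: c_def)
    moreover have "c * t \<ge> c * (2 * T1)" using c t by (intro mult_left_mono) auto
    \<comment> \<open>\<open>u_diff1\<close> gives
      \<open>u t \<ge> u T1 + (4 * c - 2 * c) * (t - T1)\<close>, and \<open>u T1\<close> is
      nonnegative.\<close>
    ultimately show ?thesis
      using u_diff1[of t] t \<open>T1 > 0\<close> by (simp add: algebra_simps)
  qed
  have r_delta_eq: "r t powr \<delta> = u t powr (- (\<delta> / \<alpha>))" for t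
    using pos by (simp add: u_def powr_powr)
  have r_alpha_eq: "r t powr \<alpha> = u t powr - 1" for t
    unfolding u_def powr_powr by simp
  have r_delta: "r t powr \<delta> \<le> c powr (- (\<delta> / \<alpha>)) * t powr - \<kappa>" if t: "t \<ge> T" for t
  proof -
    have "r t powr \<delta> \<le> (c * t) powr (- (\<delta> / \<alpha>))"
      unfolding r_delta_eq using pos c T(2)[OF t] u_ge[OF t] by (intro powr_mono2') auto
    also have "\<dots> = c powr (- (\<delta> / \<alpha>)) * t powr (- (\<delta> / \<alpha>))"
      by (rule powr_mult)
    also have "\<dots> \<le> c powr (- (\<delta> / \<alpha>)) * t powr - \<kappa>"
      using T(2)[OF t] \<kappa> by (intro mult_left_mono powr_mono) auto
    finally show ?thesis .
  qed
  have r_alpha: "r t powr \<alpha> \<le> c powr - 1 * t powr - 1" if t: "t \<ge> T" for t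
    unfolding r_alpha_eq powr_mult[symmetric]
    using c T(2)[OF t] u_ge[OF t] by (intro powr_mono2') auto

  \<comment> \<open>Refined asymptotics of \<open>u\<close>\<close>
  define C where "C = \<alpha> * M * c powr (- (\<delta> / \<alpha>))"
  have C: "C > 0" using pos c by (simp add: C_def)
  \<comment> \<open>The first summand is the discrepancy at time \<open>T\<close>, absorbed because
    \<open>t powr (1 - \<kappa>) \<ge> 1\<close>; the second comes from the antiderivative of
    \<open>C * t powr - \<kappa>\<close>.\<close>
  define K where "K = \<bar>u T - \<alpha> * a * T\<bar> + C / (1 - \<kappa>)"
  have u_approx: "\<bar>u t - \<alpha> * a * t\<bar> \<le> K * t powr (1 - \<kappa>)" if t: "t \<ge> T" for t
  proof -
    have "norm ((u t - \<alpha> * a * t) - (u T - \<alpha> * a * T))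
        \<le> C / (1 - \<kappa>) * t powr (1 - \<kappa>) - C / (1 - \<kappa>) * T powr (1 - \<kappa>)"
      using t
    proof (rule norm_diff_le_of_derivative_bound)
      fix x assume x: "T \<le> x"
      show "((\<lambda>t. u t - \<alpha> * a * t) has_vector_derivative u' x - \<alpha> * a) (at x)"
        unfolding has_real_derivative_iff_has_vector_derivative[symmetric]
        using T(2)[OF x] by (auto intro!: derivative_eq_intros u_deriv)
      show "((\<lambda>t. C / (1 - \<kappa>) * t powr (1 - \<kappa>)) has_real_derivative C * x powr - \<kappa>) (at x)"
        using T(2)[OF x] \<kappa> by (auto intro!: derivative_eq_intros)
      have "\<bar>u' x - \<alpha> * a\<bar> \<le> \<alpha> * M * r x powr \<delta>"
        using T(2)[OF x] by (intro u'_le) auto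
      also have "\<dots> \<le> \<alpha> * M * (c powr (- (\<delta> / \<alpha>)) * x powr - \<kappa>)"
        using pos by (intro mult_left_mono r_delta x) auto
      finally show "norm (u' x - \<alpha> * a) \<le> C * x powr - \<kappa>"
        by (simp add: C_def mult_ac)
    qed
    moreover have "C / (1 - \<kappa>) * T powr (1 - \<kappa>) \<ge> 0" using C \<kappa> by simp
    ultimately have "\<bar>u t - \<alpha> * a * t\<bar> \<le> \<bar>u T - \<alpha> * a * T\<bar> * 1 + C / (1 - \<kappa>) * t powr (1 - \<kappa>)"
      using abs_triangle_ineq2[of "u t - \<alpha> * a * t" "u T - \<alpha> * a * T"] by simp
    also have "\<dots> \<le> \<bar>u T - \<alpha> * a * T\<bar> * t powr (1 - \<kappa>) + C / (1 - \<kappa>) * t powr (1 - \<kappa>)"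
      using T(2)[OF t] \<kappa> by (intro add_right_mono mult_left_mono ge_one_powr_ge_zero) auto
    finally show ?thesis by (simp add: K_def distrib_right)
  qed

  \<comment> \<open>Convergence of the direction\<close>
  define D where "D = 2 * M * c powr - 1 * c powr (- (\<delta> / \<alpha>))"
  have D: "D > 0" using pos c by (simp add: D_def)
  have "((\<lambda>t. D / \<kappa> * t powr - \<kappa>) \<longlongrightarrow> D / \<kappa> * 0) at_top"
    using \<kappa> by (intro tendsto_intros tendsto_neg_powr filterlim_ident) auto
  then have rate0: "((\<lambda>t. D / \<kappa> * t powr - \<kappa>) \<longlongrightarrow> 0) at_top" by simp
  have e_cauchy: "norm (e t - e s) \<le> D / \<kappa> * s powr - \<kappa>" if s: "T \<le> s" and "s \<le> t" for s t
  proof -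
    \<comment> \<open>The majorant is the antiderivative
      \<open>- D / \<kappa> * t powr - \<kappa>\<close> of
      \<open>D * t powr (- \<kappa> - 1)\<close>. Its term at \<open>t\<close> has a favourable
      sign; dropping it leaves a bound depending on \<open>s\<close> alone.\<close>
    have "norm (e t - e s) \<le> - D / \<kappa> * t powr - \<kappa> - (- D / \<kappa> * s powr - \<kappa>)"
      using \<open>s \<le> t\<close>
    proof (rule norm_diff_le_of_derivative_bound)
      fix x assume "s \<le> x"
      then have x: "T \<le> x" using s by simp
      show "(e has_vector_derivative e' x) (at x)"
        using T(2)[OF x] by (intro e_deriv) auto
      show "((\<lambda>t. - D / \<kappa> * t powr - \<kappa>) has_real_derivative D * x powr (- \<kappa> - 1)) (at x)"
        using T(2)[OF x] \<kappa> by (auto intro!: derivative_eq_intros)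
      have "norm (e' x) \<le> 2 * M * (r x powr \<alpha> * r x powr \<delta>)"
        using T(2)[OF x] by (intro e'_le) auto
      also have "\<dots> \<le> 2 * M * ((c powr - 1 * x powr - 1) * (c powr (- (\<delta> / \<alpha>)) * x powr - \<kappa>))"
        using pos by (intro mult_left_mono mult_mono r_alpha r_delta x) auto
      also have "\<dots> = D * (x powr - 1 * x powr - \<kappa>)"
        by (simp only: D_def mult_ac)
      also have "x powr - 1 * x powr - \<kappa> = x powr (- \<kappa> - 1)"
        unfolding powr_add[symmetric] by (simp add: minus_diff_commute)
      finally show "norm (e' x) \<le> D * x powr (- \<kappa> - 1)" .
    qed
    moreover have "D / \<kappa> * t powr - \<kappa> \<ge> 0" using D \<kappa> by simp
    ultimately show ?thesis by simp
  qed
  obtain L where L: "(e \<longlongrightarrow> L) at_top"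
    and e_approx: "\<And>s. T \<le> s \<Longrightarrow> norm (e s - L) \<le> D / \<kappa> * s powr - \<kappa>"
    using tendsto_at_top_with_rate[OF rate0 e_cauchy] by blast
  have "((\<lambda>t. norm (e t)) \<longlongrightarrow> norm L) at_top"
    by (intro tendsto_norm L)
  moreover have "((\<lambda>t. norm (e t)) \<longlongrightarrow> 1) at_top"
    using norm_e by (intro tendsto_eventually eventually_mono[OF eventually_gt_at_top[of tstar]])
  ultimately have norm_L: "norm L = 1"
    using tendsto_unique[OF trivial_limit_at_top_linorder] by blast

  \<comment> \<open>The limit vector and the final error estimate\<close>
  define \<beta> where "\<beta> = 1 / \<alpha>"
  have \<beta>: "\<beta> > 0" "- 1 / \<alpha> = - \<beta>" "\<alpha> * \<beta> = 1" using pos by (auto simp: \<beta>_def)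
  define B where "B = \<beta> * c powr (- \<beta> - 1) * K + (\<alpha> * a) powr - \<beta> * (D / \<kappa>)"
  \<comment> \<open>Since \<open>r = u powr - \<beta>\<close> with \<open>u\<close> close to
    \<open>\<alpha> * a * t\<close> and \<open>e\<close> close to \<open>L\<close>, this is the
    coefficient of \<open>t powr - \<beta>\<close> in \<open>y\<close>.\<close>
  define \<xi> where "\<xi> = (\<alpha> * a) powr - \<beta> *\<^sub>R L"
  have "\<xi> \<noteq> 0" using norm_L pos by (auto simp: \<xi>_def)
  moreover have "\<alpha> * a * norm \<xi> powr \<alpha> = 1"
  proof -
    have "norm \<xi> powr \<alpha> = (\<alpha> * a) powr (- \<beta> * \<alpha>)"
      using norm_L by (simp add: \<xi>_def powr_powr)
    also have "- \<beta> * \<alpha> = - 1" using \<beta>(3) by (simp add: mult.commute)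
    finally show ?thesis using pos by (simp add: powr_minus_divide)
  qed
  moreover have "(\<lambda>t. norm (y t - t powr - \<beta> *\<^sub>R \<xi>)) \<in> O[at_top](\<lambda>t. t powr (- \<beta> - \<kappa>))"
  proof (rule bigoI[where c = B])
    have "norm (y t - t powr - \<beta> *\<^sub>R \<xi>) \<le> B * t powr (- \<beta> - \<kappa>)" if t: "t \<ge> T" for t
    proof -
      note t' = T(2)[OF t]
      let ?v = "\<alpha> * a * t"
      \<comment> \<open>Both \<open>u t\<close> and \<open>?v = 4 * (c * t)\<close> are at least
        \<open>c * t\<close>, which serves as the \<open>m\<close> of the lemma.\<close>
      have "\<bar>u t powr - \<beta> - ?v powr - \<beta>\<bar> \<le> \<beta> * (c * t) powr (- \<beta> - 1) * \<bar>u t - ?v\<bar>"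
      proof (rule abs_powr_diff_le)
        have "?v = 4 * (c * t)" by (simp add: c_def)
        then show "c * t \<le> ?v" using c t' by simp
      qed (use \<beta> c t' u_ge[OF t] in auto)
      also have "\<dots> \<le> \<beta> * (c * t) powr (- \<beta> - 1) * (K * t powr (1 - \<kappa>))"
        using \<beta> by (intro mult_left_mono u_approx t) auto
      also have "\<dots> = \<beta> * c powr (- \<beta> - 1) * K * (t powr (- \<beta> - 1) * t powr (1 - \<kappa>))"
        by (simp only: powr_mult mult_ac)
      \<comment> \<open>The derivative of the power gains a factor of order \<open>1 / t\<close>,
        against an error in \<open>u\<close> of order \<open>t powr (1 - \<kappa>)\<close>: the net
        gain is \<open>t powr - \<kappa>\<close>.\<close>
      also have "t powr (- \<beta> - 1) * t powr (1 - \<kappa>) = t powr (- \<beta> - \<kappa>)"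
        unfolding powr_add[symmetric] by simp
      finally have radial: "\<bar>u t powr - \<beta> - ?v powr - \<beta>\<bar> \<le> \<beta> * c powr (- \<beta> - 1) * K * t powr (- \<beta> - \<kappa>)" .
      have "?v powr - \<beta> * norm (e t - L) \<le> ?v powr - \<beta> * (D / \<kappa> * t powr - \<kappa>)"
        by (intro mult_left_mono e_approx t) auto
      also have "\<dots> = (\<alpha> * a) powr - \<beta> * (D / \<kappa>) * (t powr - \<beta> * t powr - \<kappa>)"
        by (simp only: powr_mult mult_ac)
      also have "t powr - \<beta> * t powr - \<kappa> = t powr (- \<beta> - \<kappa>)"
        unfolding powr_add[symmetric] by simp
      finally have angular: "?v powr - \<beta> * norm (e t - L)
          \<le> (\<alpha> * a) powr - \<beta> * (D / \<kappa>) * t powr (- \<beta> - \<kappa>)" .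
      have "r t = u t powr - \<beta>"
        using \<beta>(3) r_pos[of t] t' by (simp add: u_def powr_powr)
      moreover have "t powr - \<beta> *\<^sub>R \<xi> = ?v powr - \<beta> *\<^sub>R L"
        by (simp add: \<xi>_def powr_mult mult_ac)
      \<comment> \<open>Inserting \<open>?v powr - \<beta> *\<^sub>R e t\<close> separates the error
        in length from the error in direction.\<close>
      ultimately have "y t - t powr - \<beta> *\<^sub>R \<xi>
          = (u t powr - \<beta> - ?v powr - \<beta>) *\<^sub>R e t + ?v powr - \<beta> *\<^sub>R (e t - L)"
        by (simp add: y_eq[of t] scaleR_left_diff_distrib scaleR_right_diff_distrib)
      then have "norm (y t - t powr - \<beta> *\<^sub>R \<xi>)
          \<le> \<bar>u t powr - \<beta> - ?v powr - \<beta>\<bar> + ?v powr - \<beta> * norm (e t - L)"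
        using norm_triangle_ineq[of "(u t powr - \<beta> - ?v powr - \<beta>) *\<^sub>R e t"
            "?v powr - \<beta> *\<^sub>R (e t - L)"] norm_e[of t] t' by simp
      also have "\<dots> \<le> B * t powr (- \<beta> - \<kappa>)"
        unfolding B_def distrib_right by (rule add_mono[OF radial angular])
      finally show ?thesis .
    qed
    then show "\<forall>\<^sub>F t in at_top. norm (norm (y t - t powr - \<beta> *\<^sub>R \<xi>)) \<le> B * norm (t powr (- \<beta> - \<kappa>))"
      by (intro eventually_mono[OF eventually_ge_at_top[of T]]) auto
  qed
  \<comment> \<open>The witness for \<open>\<epsilon>\<close> is \<open>\<kappa>\<close>.\<close>
  ultimately show ?thesis using \<kappa>(1) unfolding \<beta>(2) by blast
qed

end
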